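(* Assume (h1), (h2) and (h3) (stated in the context). For every initial condition $(t,x)\in[0,T]\times\mathbb{R}^n$, every admissible arc $y\in A(t,x)$ and every $\tau\in[t,T]$, $$ U(t,x)\supseteq \int_t^\tau \mathcal{L}_t(s,\dot y(s))\,ds\ \oplus\ \inf_{\eta\in A(\tau,y(\tau))}\bigl[W(t,\tau,\eta)+J_\tau(\eta)\bigr], $$ where, for $\eta\in W^{1,1}([\tau,T],\mathbb{R}^n)$, $W(t,\tau,\eta)\in\mathbb{R}^d$ is $$ W(t,\tau,\eta)=\int_\tau^T\bigl(d_t(s)-d_\tau(s)\bigr)L(\dot\eta(s))\,ds+\bigl(d_t(T)-d_\tau(T)\bigr)g(\eta(T)). $$ Moreover, a set $M\subset A(t,x)$ is an infimizer for the problem of minimizing $J_t(y)$ over $y\in A(t,x)$ (i.e. $\inf_{y\in M}J_t(y)=\inf_{y\in A(t,x)}J_t(y)$) if and only if for all $\tau\in[t,T]$ $$ U(t,x)=\inf_{y\in M}\Bigl[\int_t^\tau \mathcal{L}_t(s,\dot y(s))\,ds\ \oplus\ \inf_{\eta\in A(\tau,y(\tau))}\bigl[W(t,\tau,\eta)+J_\tau(\eta)\bigr]\Bigr]. $$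
   Context: Let $C\subset\mathbb{R}^d$ be a closed convex cone with nonempty interior and $C^+=\{\zeta\in\mathbb{R}^d : \zeta\cdot z\ge 0\ \forall z\in C\}$. For $A,B\subseteq\mathbb{R}^d$, $A+B$ is the Minkowski sum (with $A+\emptyset=\emptyset$) and $A\oplus B=\mathrm{cl}(A+B)$; a vector added to a set is a translation. $\mathcal{F}(\mathbb{R}^d,C)=\{A\subseteq\mathbb{R}^d : A=A\oplus C\}$, ordered by $\supseteq$, is a complete lattice with $\inf\mathcal{A}=\mathrm{cl}\bigcup_{A\in\mathcal{A}}A$ and $\sup\mathcal{A}=\bigcap_{A\in\mathcal{A}}A$. Let $T>0$, $L:\mathbb{R}^n\to\mathbb{R}^d$, $g:\mathbb{R}^n\to\mathbb{R}^d$, and let $d_t(s)>0$ ($t\in[0,T]$, $s\in[t,T]$) be a discount factor. For $\zeta\in C^+\setminus\{0\}$ put $L_\zeta(w)=L(w)\cdot\zeta$, $g_\zeta(w)=g(w)\cdot\zeta$. Let $B^+$ be a base of $C^+$ (each $\zeta\in C^+\setminus\{0\}$ is uniquely $\lambda\xi$ with $\lambda>0$, $\xi\in B^+$). Hypotheses: (h1) for all $\zeta\in B^+$, $L_\zeta$ is $C^2$, strictly convex and coercive: $\lim_{|w|\to\infty}L_\zeta(w)/|w|=+\infty$; (h2) for all $\zeta\in B^+$, $g_\zeta$ is globally Lipschitz in $\mathbb{R}^n$; (h3) for any $t\in[0,T]$, $d_t:[t,T]\to(a,1]$, with $a>0$, is continuous, and $d_t(t)=1$. Define $\mathcal{L}_t(s,w)=d_t(s)L(w)+C$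 for $s\in[t,T]$, $w\in\mathbb{R}^n$. For $y\in W^{1,1}([t,T],\mathbb{R}^n)$ put $J_t(y)=\int_t^T\mathcal{L}_t(s,\dot y(s))\,ds+d_t(T)g(y(T))\in\mathcal{F}(\mathbb{R}^d,C)$, where integrals of set-valued functions are Aumann integrals and, by convention, $\int_t^tF(s)\,ds=C$ for $F:[0,T]\to\mathcal{F}(\mathbb{R}^d,C)$. The admissible set is $A(t,x)=\{y\in W^{1,1}([t,T],\mathbb{R}^n): y(t)=x\}$; for $t=T$, $A(T,x)$ is identified with the single point $\{x\}$. The value function is $U(t,x)=\inf_{y\in A(t,x)}J_t(y)$ (infimum in $\mathcal{F}(\mathbb{R}^d,C)$). *)

theory Defs
  imports "HOL-Analysis.Analysis" "HOL-Library.Set_Algebras"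
begin

section \<open>Cones and the lattice of closed $C$-monotone sets\<close>

definition pos_dual :: "('a::real_inner) set \<Rightarrow> 'a set" where
  "pos_dual C = {\<zeta>. \<forall>z\<in>C. 0 \<le> \<zeta> \<bullet> z}"

definition is_base :: "('a::real_vector) set \<Rightarrow> 'a set \<Rightarrow> bool" where
  "is_base B K \<longleftrightarrow> B \<subseteq> K - {0} \<and>
     (\<forall>\<zeta>\<in>K - {0}. \<exists>!(c::real, \<xi>). 0 < c \<and> \<xi> \<in> B \<and> \<zeta> = c *\<^sub>R \<xi>)"

text \<open>
  Minkowski sums and translations are \<open>A + B\<close> and \<open>v +o A\<close> of \<^theory>\<open>HOL-Library.Set_Algebras\<close>.
\<close>

definition cl_plus :: "('a::real_normed_vector) set \<Rightarrow> 'a set \<Rightarrow> 'a set" where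
  "cl_plus A B = closure (A + B)"

text \<open>
  The infimum of a family in \<open>{A. A = cl_plus A C}\<close>, ordered by \<open>\<supseteq>\<close>. In particular \<open>{}\<close> is the
  top element of the lattice and contributes nothing to an infimum.
\<close>

definition inf_cl :: "('a::real_normed_vector) set set \<Rightarrow> 'a set" where
  "inf_cl \<A> = closure (\<Union>\<A>)"

section \<open>Regularity of the scalarizations\<close>

text \<open>\<open>G\<close> is the gradient and \<open>H\<close> the Hessian.\<close>

definition C2_fun :: "(real^'n \<Rightarrow> real) \<Rightarrow> bool" where
  "C2_fun f \<longleftrightarrow> (\<exists>(G :: real^'n \<Rightarrow> real^'n) (H :: real^'n \<Rightarrow> real^'n^'n).
     (\<forall>x. (f has_derivative (\<lambda>h. G x \<bullet> h)) (at x)) \<and>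
     (\<forall>x. (G has_derivative (\<lambda>h. H x *v h)) (at x)) \<and>
     continuous_on UNIV H)"

definition strictly_convex :: "('a::real_vector \<Rightarrow> real) \<Rightarrow> bool" where
  "strictly_convex f \<longleftrightarrow> (\<forall>x y. \<forall>u\<in>{0<..<1}. x \<noteq> y \<longrightarrow>
     f (u *\<^sub>R x + (1 - u) *\<^sub>R y) < u * f x + (1 - u) * f y)"

definition coercive :: "('a::real_normed_vector \<Rightarrow> real) \<Rightarrow> bool" where
  "coercive f \<longleftrightarrow> filterlim (\<lambda>w. f w / norm w) at_top at_infinity"

section \<open>Arcs\<close>

text \<open>
  An element of $W^{1,1}([a,b])$ is represented by its absolutely continuous representative, that
  is, by an indefinite Lebesgue integral of an integrable function, its weak derivative.  Only the
  values on \<open>{a..b}\<close> matter; functions are unconstrained elsewhere.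
\<close>

definition has_weak_derivative_on ::
    "(real \<Rightarrow> 'a::euclidean_space) \<Rightarrow> (real \<Rightarrow> 'a) \<Rightarrow> real \<Rightarrow> real \<Rightarrow> bool" where
  "has_weak_derivative_on y v a b \<longleftrightarrow> v absolutely_integrable_on {a..b} \<and>
     (\<forall>s\<in>{a..b}. y s = y a + integral {a..s} v)"

definition W11 :: "real \<Rightarrow> real \<Rightarrow> (real \<Rightarrow> 'a::euclidean_space) set" where
  "W11 a b = {y. \<exists>v. has_weak_derivative_on y v a b}"

text \<open>
  The weak derivative is unique up to null sets, and is used only under integrals that do not see
  null sets, so the choice of a version is immaterial.
\<close>

definition weak_deriv :: "real \<Rightarrow> real \<Rightarrow> (real \<Rightarrow> 'a::euclidean_space) \<Rightarrow> real \<Rightarrow> 'a" where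
  "weak_deriv a b y = (SOME v. has_weak_derivative_on y v a b)"

text \<open>
  For \<open>t = T\<close> membership only says \<open>y T = x\<close>, and all costs below then depend on \<open>y T\<close> alone:
  this is the identification of the admissible set with the single point \<open>x\<close>.
\<close>

definition admissible :: "real \<Rightarrow> real \<Rightarrow> 'a::euclidean_space \<Rightarrow> (real \<Rightarrow> 'a) set" where
  "admissible T t x = {y \<in> W11 t T. y t = x}"

section \<open>The set-valued Bolza problem\<close>

text \<open>
  The Aumann integral: the set of integrals of Lebesgue integrable selections, with the convention
  that the integral over a degenerate interval is \<open>C\<close> (instead of \<open>{0}\<close>).
\<close>

definition aumann_integral ::
    "'b::euclidean_space set \<Rightarrow> real \<Rightarrow> real \<Rightarrow> (real \<Rightarrow> 'b set) \<Rightarrow> 'b set" where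
  "aumann_integral C a b F = (if a = b then C else
     {integral {a..b} f | f. f absolutely_integrable_on {a..b} \<and>
        (AE s in lebesgue_on {a..b}. f s \<in> F s)})"

definition set_lagrangian ::
    "'b::euclidean_space set \<Rightarrow> ('a \<Rightarrow> 'b) \<Rightarrow> (real \<Rightarrow> real \<Rightarrow> real) \<Rightarrow> real \<Rightarrow> real \<Rightarrow> 'a \<Rightarrow> 'b set" where
  "set_lagrangian C L d t s w = (d t s *\<^sub>R L w) +o C"

definition running_cost ::
    "'b::euclidean_space set \<Rightarrow> ('a::euclidean_space \<Rightarrow> 'b) \<Rightarrow> (real \<Rightarrow> real \<Rightarrow> real) \<Rightarrow> real
      \<Rightarrow> real \<Rightarrow> real \<Rightarrow> (real \<Rightarrow> 'a) \<Rightarrow> 'b set" where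
  "running_cost C L d T t \<tau> y =
     aumann_integral C t \<tau> (\<lambda>s. set_lagrangian C L d t s (weak_deriv t T y s))"

definition J ::
    "'b::euclidean_space set \<Rightarrow> ('a::euclidean_space \<Rightarrow> 'b) \<Rightarrow> ('a \<Rightarrow> 'b) \<Rightarrow> (real \<Rightarrow> real \<Rightarrow> real)
      \<Rightarrow> real \<Rightarrow> real \<Rightarrow> (real \<Rightarrow> 'a) \<Rightarrow> 'b set" where
  "J C L g d T t y = (d t T *\<^sub>R g (y T)) +o running_cost C L d T t T y"

definition value_fun ::
    "'b::euclidean_space set \<Rightarrow> ('a::euclidean_space \<Rightarrow> 'b) \<Rightarrow> ('a \<Rightarrow> 'b) \<Rightarrow> (real \<Rightarrow> real \<Rightarrow> real)
      \<Rightarrow> real \<Rightarrow> real \<Rightarrow> 'a \<Rightarrow> 'b set" where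
  "value_fun C L g d T t x = inf_cl (J C L g d T t ` admissible T t x)"

definition infimizer ::
    "'b::euclidean_space set \<Rightarrow> ('a::euclidean_space \<Rightarrow> 'b) \<Rightarrow> ('a \<Rightarrow> 'b) \<Rightarrow> (real \<Rightarrow> real \<Rightarrow> real)
      \<Rightarrow> real \<Rightarrow> real \<Rightarrow> 'a \<Rightarrow> (real \<Rightarrow> 'a) set \<Rightarrow> bool" where
  "infimizer C L g d T t x M \<longleftrightarrow>
     inf_cl (J C L g d T t ` M) = inf_cl (J C L g d T t ` admissible T t x)"

section \<open>The correction term for general discounting\<close>

definition W_integrand ::
    "('a::euclidean_space \<Rightarrow> 'b::euclidean_space) \<Rightarrow> (real \<Rightarrow> real \<Rightarrow> real)
      \<Rightarrow> real \<Rightarrow> real \<Rightarrow> real \<Rightarrow> (real \<Rightarrow> 'a) \<Rightarrow> real \<Rightarrow> 'b" where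
  "W_integrand L d T t \<tau> \<eta> s = (d t s - d \<tau> s) *\<^sub>R L (weak_deriv \<tau> T \<eta> s)"

definition W ::
    "('a::euclidean_space \<Rightarrow> 'b::euclidean_space) \<Rightarrow> ('a \<Rightarrow> 'b) \<Rightarrow> (real \<Rightarrow> real \<Rightarrow> real)
      \<Rightarrow> real \<Rightarrow> real \<Rightarrow> real \<Rightarrow> (real \<Rightarrow> 'a) \<Rightarrow> 'b" where
  "W L g d T t \<tau> \<eta> =
     integral {\<tau>..T} (W_integrand L d T t \<tau> \<eta>) + (d t T - d \<tau> T) *\<^sub>R g (\<eta> T)"

text \<open>
  The sum of \<open>W\<close> and \<open>J\<close>.  The integral in \<open>W\<close> need not exist for every arc.  Such an arc is given
  the value \<open>{}\<close> (the top element), so that it does not contribute to the infimum, rather than the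
  meaningless sum with the default value of \<^const>\<open>integral\<close>.  If \<open>C\<close> is pointed (and the data are
  regular) this is no convention at all: then \<open>J\<close> itself is \<open>{}\<close> for every such arc.
\<close>

definition W_plus_J ::
    "'b::euclidean_space set \<Rightarrow> ('a::euclidean_space \<Rightarrow> 'b) \<Rightarrow> ('a \<Rightarrow> 'b) \<Rightarrow> (real \<Rightarrow> real \<Rightarrow> real)
      \<Rightarrow> real \<Rightarrow> real \<Rightarrow> real \<Rightarrow> (real \<Rightarrow> 'a) \<Rightarrow> 'b set" where
  "W_plus_J C L g d T t \<tau> \<eta> =
     (if W_integrand L d T t \<tau> \<eta> absolutely_integrable_on {\<tau>..T}
      then W L g d T t \<tau> \<eta> +o J C L g d T \<tau> \<eta> else {})"

end

theory Submission
  imports Defs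
begin

text \<open>
  Fix \<open>t\<close> and \<open>x\<close>, write \<open>U\<close> for the value function, and for an admissible arc \<open>y\<close> let \<open>R \<tau> y\<close> be the set
  obtained by following \<open>y\<close> up to time \<open>\<tau>\<close> and continuing with the infimum of \<open>W + J\<close> over the arcs from
  \<open>(\<tau>, y \<tau>)\<close>.  Everything follows from three inclusions:
  \<open>J y \<subseteq> R \<tau> y\<close>, \<open>R \<tau> y \<subseteq> U\<close> and \<open>R T y \<subseteq> closure (J y)\<close>.
  The second one is the first claim.  If \<open>M\<close> is an infimizer, the infimum over \<open>M\<close> of \<open>R \<tau> y\<close> lies
  between that of \<open>J y\<close>, which is \<open>U\<close>, and \<open>U\<close>; conversely the condition at \<open>\<tau> = T\<close> and the third
  inclusion give back that \<open>M\<close> is an infimizer.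

  The correction \<open>W\<close> is made so that \<open>W + J\<close> on \<open>[\<tau>, T]\<close> is the remaining cost discounted from the
  initial time \<open>t\<close> (\<open>W_plus_J_eq_rediscounted\<close>).  Pasting arcs and the additivity of Aumann integrals
  over adjacent intervals (\<open>aumann_integral_combine\<close>) then yield the second inclusion, in
  \<open>concatenation_subset_value_fun\<close>, and the third one.

  The first inclusion is the delicate one, since an arc \<open>y\<close> of nonempty cost may have a nonintegrable
  correction term if \<open>C\<close> contains lines.  What survives is convexity: the epigraph
  \<open>{(w, z). z \<in> L w + C}\<close> is convex and closed, because it is the intersection of the epigraphs of the
  scalarizations of \<open>L\<close>.  A pair consisting of the velocity of \<open>y\<close> and of a selection divided by the discount
  lies in it almost everywhere, hence so do the averages of the pair over short intervals.  Averaging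
  therefore produces arcs with piecewise constant velocity and the same end points, whose
  corrections are integrable and whose costs converge because the discount is continuous
  (\<open>piecewise_constant_velocity_approximation\<close>).
\<close>

section \<open>Null sets, pasting and averages\<close>

lemma AE_lebesgue_on_Icc_iff:
  fixes a b :: real
  shows "(AE s in lebesgue_on {a..b}. P s) \<longleftrightarrow> (\<exists>N. negligible N \<and> (\<forall>s\<in>{a..b} - N. P s))"
proof -
  have "(AE s in lebesgue_on {a..b}. P s) \<longleftrightarrow> (AE s in lebesgue. s \<in> {a..b} \<longrightarrow> P s)"
    by (rule AE_restrict_space_iff) simp
  also have "\<dots> \<longleftrightarrow> (\<exists>N. negligible N \<and> (\<forall>s\<in>{a..b} - N. P s))"
  proof
    assume "AE s in lebesgue. s \<in> {a..b} \<longrightarrow> P s"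
    then obtain N where "N \<in> null_sets lebesgue" "{s \<in> space lebesgue. \<not> (s \<in> {a..b} \<longrightarrow> P s)} \<subseteq> N"
      unfolding eventually_ae_filter by blast
    then show "\<exists>N. negligible N \<and> (\<forall>s\<in>{a..b} - N. P s)"
      by (intro exI[of _ N]) (auto simp: negligible_iff_null_sets)
  next
    assume "\<exists>N. negligible N \<and> (\<forall>s\<in>{a..b} - N. P s)"
    then obtain N where "N \<in> null_sets lebesgue" "\<forall>s\<in>{a..b} - N. P s"
      unfolding negligible_iff_null_sets by blast
    then show "AE s in lebesgue. s \<in> {a..b} \<longrightarrow> P s"
      by (intro AE_I'[of N]) auto
  qed
  finally show ?thesis .
qed

lemma absolutely_integrable_spike_AE:
  fixes f g :: "real \<Rightarrow> 'a::euclidean_space"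
  assumes "f absolutely_integrable_on {a..b}" "AE s in lebesgue_on {a..b}. g s = f s"
  shows "g absolutely_integrable_on {a..b}"
  using assms unfolding AE_lebesgue_on_Icc_iff by (blast intro: absolutely_integrable_spike)

lemma AE_lebesgue_on_subinterval:
  fixes a b :: real
  assumes "AE s in lebesgue_on {a..b}. P s" "{c..e} \<subseteq> {a..b}"
  shows "AE s in lebesgue_on {c..e}. P s"
  using assms unfolding AE_lebesgue_on_Icc_iff by blast

lemma absolutely_integrable_continuous_scaleR:
  fixes k :: "real \<Rightarrow> real" and f :: "real \<Rightarrow> 'a::euclidean_space"
  assumes "continuous_on {a..b} k" "f absolutely_integrable_on {a..b}"
  shows "(\<lambda>s. k s *\<^sub>R f s) absolutely_integrable_on {a..b}"
proof (rule absolutely_integrable_bounded_measurable_product[where h = "(*\<^sub>R)"])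
  show "bilinear ((*\<^sub>R) :: real \<Rightarrow> 'a \<Rightarrow> 'a)"
    by (simp add: bilinear_conv_bounded_bilinear bounded_bilinear_scaleR)
  show "k \<in> borel_measurable (lebesgue_on {a..b})"
    using assms(1) by (simp add: continuous_imp_measurable_on_sets_lebesgue)
  show "bounded (k ` {a..b})"
    using assms(1) compact_Icc compact_continuous_image compact_imp_bounded by blast
qed (use assms in auto)

lemma
  fixes f g :: "real \<Rightarrow> 'a::euclidean_space"
  assumes f: "f absolutely_integrable_on {a..b}" and g: "g absolutely_integrable_on {b..c}"
    and ab: "a \<le> b" "b \<le> c"
  shows absolutely_integrable_paste:
      "(\<lambda>s. if s \<le> b then f s else g s) absolutely_integrable_on {a..c}"
    and integral_paste:
      "integral {a..c} (\<lambda>s. if s \<le> b then f s else g s) = integral {a..b} f + integral {b..c} g"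
proof -
  let ?h = "\<lambda>s. if s \<le> b then f s else g s"
  have N: "negligible {b}" by simp
  have hf: "?h absolutely_integrable_on {a..b}"
    by (rule absolutely_integrable_spike[OF f negligible_empty]) auto
  have hg: "?h absolutely_integrable_on {b..c}"
    by (rule absolutely_integrable_spike[OF g N]) auto
  show *: "?h absolutely_integrable_on {a..c}"
    by (rule absolutely_integrable_on_combine[OF hf hg ab])
  have "integral {a..c} ?h = integral {a..b} ?h + integral {b..c} ?h"
    using Henstock_Kurzweil_Integration.integral_combine[OF ab set_lebesgue_integral_eq_integral(1)[OF *]]
    by simp
  also have "integral {a..b} ?h = integral {a..b} f"
    by (rule integral_cong) auto
  also have "integral {b..c} ?h = integral {b..c} g"
    by (rule integral_spike[OF N]) auto
  finally show "integral {a..c} ?h = integral {a..b} f + integral {b..c} g" .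
qed

text \<open>
  Jensen's inequality in geometric form.  If the average lay outside, a hyperplane would strictly
  separate it from \<open>S\<close>; averaging the linear inequality satisfied by the values of \<open>f\<close> contradicts this.
\<close>

lemma average_in_closed_convex:
  fixes f :: "real \<Rightarrow> 'a::euclidean_space"
  assumes S: "convex S" "closed S" and ab: "a < b" and f: "f integrable_on {a..b}"
    and fS: "AE s in lebesgue_on {a..b}. f s \<in> S"
  shows "(1 / (b - a)) *\<^sub>R integral {a..b} f \<in> S"
proof (rule ccontr)
  assume "\<not> ?thesis"
  from separating_hyperplane_closed_point[OF S this] obtain n \<beta>
    where n: "n \<bullet> ((1 / (b - a)) *\<^sub>R integral {a..b} f) < \<beta>" "\<And>x. x \<in> S \<Longrightarrow> \<beta> < n \<bullet> x"
    by blast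
  obtain N where N: "negligible N" "\<And>s. s \<in> {a..b} - N \<Longrightarrow> f s \<in> S"
    using fS unfolding AE_lebesgue_on_Icc_iff by blast
  have fi: "((\<lambda>s. n \<bullet> f s) has_integral n \<bullet> integral {a..b} f) {a..b}"
    using has_integral_linear[OF integrable_integral[OF f] bounded_linear_inner_right[of n]]
    by (simp add: o_def)
  have upper: "((\<lambda>s. if s \<in> N then \<beta> else n \<bullet> f s) has_integral n \<bullet> integral {a..b} f) {a..b}"
    by (rule has_integral_spike[OF N(1) _ fi]) auto
  have lower: "((\<lambda>s. \<beta>) has_integral (b - a) *\<^sub>R \<beta>) {a..b}"
    using has_integral_const_real[of \<beta> a b] ab by simp
  have "(b - a) *\<^sub>R \<beta> \<le> n \<bullet> integral {a..b} f"
  proof (rule has_integral_le[OF lower upper])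
    fix s assume "s \<in> {a..b}"
    then show "\<beta> \<le> (if s \<in> N then \<beta> else n \<bullet> f s)"
      using n(2)[of "f s"] N(2)[of s] by auto
  qed
  then have "\<beta> \<le> n \<bullet> ((1 / (b - a)) *\<^sub>R integral {a..b} f)"
    using ab by (simp add: field_simps)
  with n(1) show False by simp
qed

section \<open>Weak derivatives\<close>

text \<open>
  By the Lebesgue differentiation theorem almost every value of \<open>u\<close> is a limit of averages over
  small intervals to the right, and all these averages vanish.
\<close>

lemma integral_zero_on_subintervals_imp_AE_zero:
  fixes u :: "real \<Rightarrow> 'a::euclidean_space"
  assumes u: "u integrable_on {a..b}"
    and zero: "\<And>c e. a \<le> c \<Longrightarrow> c \<le> e \<Longrightarrow> e \<le> b \<Longrightarrow> integral {c..e} u = 0"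
  shows "AE s in lebesgue_on {a..b}. u s = 0"
proof -
  let ?u = "\<lambda>s. if s \<in> {a..b} then u s else 0"
  have "?u integrable_on UNIV"
    using u by (simp only: integrable_restrict_UNIV)
  then have "?u integrable_on cbox c e" for c e
    using integrable_on_subcbox by blast
  from integrable_ccontinuous_explicit[OF this] obtain N where N: "negligible N"
    "\<And>x e. \<lbrakk>x \<notin> N; 0 < e\<rbrakk> \<Longrightarrow> \<exists>d>0. \<forall>h. 0 < h \<and> h < d \<longrightarrow>
       norm (integral {x..x + h} ?u /\<^sub>R h - ?u x) < e"
    by (auto simp: cbox_interval) 
  have "u x = 0" if x: "x \<in> {a..b} - (N \<union> {b})" for x
  proof (rule ccontr)
    assume "u x \<noteq> 0"
    then obtain d where d: "d > 0" "\<And>h. 0 < h \<Longrightarrow> h < d \<Longrightarrow>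
       norm (integral {x..x + h} ?u /\<^sub>R h - ?u x) < norm (u x)"
      using N(2)[of x "norm (u x)"] x by auto
    \<comment> \<open>Both bounds matter: \<open>h < d\<close>, and the interval must not leave \<open>{a..b}\<close>, where \<open>?u\<close> is \<open>u\<close>.\<close>
    define h where "h = min (d / 2) (b - x)"
    have h: "0 < h" "h < d" "x + h \<le> b" using d(1) x by (auto simp: h_def)
    have "integral {x..x + h} ?u = integral {x..x + h} u"
      using h x by (intro integral_cong) auto
    also have "\<dots> = 0" using h x by (intro zero) auto
    finally show False using d(2)[OF h(1,2)] x by simp
  qed
  moreover have "negligible (N \<union> {b})" using N(1) by simp
  ultimately show ?thesis unfolding AE_lebesgue_on_Icc_iff by blast
qed

lemma weak_derivative_unique:
  assumes v: "has_weak_derivative_on y v a b" and w: "has_weak_derivative_on y w a b"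
  shows "AE s in lebesgue_on {a..b}. v s = w s"
proof -
  have iv: "v integrable_on {a..b}" and iw: "w integrable_on {a..b}"
    using v w set_lebesgue_integral_eq_integral(1) unfolding has_weak_derivative_on_def by blast+
  have eq: "integral {a..s} v = integral {a..s} w" if "s \<in> {a..b}" for s
    using v w that unfolding has_weak_derivative_on_def by (metis add_left_cancel)
  have "integral {c..e} (\<lambda>s. v s - w s) = 0" if ce: "a \<le> c" "c \<le> e" "e \<le> b" for c e
  proof -
    have sub: "f integrable_on {a..e}" "f integrable_on {c..e}"
      if "f integrable_on {a..b}" for f :: "real \<Rightarrow> 'a"
      using integrable_on_subinterval[OF that] ce by auto
    have "integral {c..e} v = integral {c..e} w"
      using Henstock_Kurzweil_Integration.integral_combine[OF ce(1,2) sub(1)[OF iv]]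
        Henstock_Kurzweil_Integration.integral_combine[OF ce(1,2) sub(1)[OF iw]]
        eq[of c] eq[of e] ce by (metis add_left_cancel atLeastAtMost_iff order_trans)
    then show ?thesis
      by (simp add: Henstock_Kurzweil_Integration.integral_diff sub iv iw)
  qed
  from integral_zero_on_subintervals_imp_AE_zero[OF Henstock_Kurzweil_Integration.integrable_diff[OF iv iw] this]
  show ?thesis by simp
qed

lemma weak_deriv_has_weak_derivative:
  "y \<in> W11 a b \<Longrightarrow> has_weak_derivative_on y (weak_deriv a b y) a b"
  unfolding W11_def weak_deriv_def mem_Collect_eq
  by (rule someI_ex[of "\<lambda>v. has_weak_derivative_on y v a b"])

lemma weak_deriv_AE_eq:
  assumes "has_weak_derivative_on y v a b"
  shows "AE s in lebesgue_on {a..b}. weak_deriv a b y s = v s"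
proof -
  have "y \<in> W11 a b" using assms unfolding W11_def by auto
  from weak_derivative_unique[OF weak_deriv_has_weak_derivative[OF this] assms] show ?thesis .
qed

lemma has_weak_derivative_on_subinterval:
  assumes v: "has_weak_derivative_on y v a b" and "a \<le> c" "c \<le> e" "e \<le> b"
  shows "has_weak_derivative_on y v c e"
  unfolding has_weak_derivative_on_def
proof (intro conjI ballI)
  have vi: "v absolutely_integrable_on {a..b}"
    and y: "\<And>s. s \<in> {a..b} \<Longrightarrow> y s = y a + integral {a..s} v"
    using v unfolding has_weak_derivative_on_def by blast+
  show "v absolutely_integrable_on {c..e}"
    using absolutely_integrable_on_subinterval[OF vi] assms by auto
  fix s assume s: "s \<in> {c..e}"
  have "v integrable_on {a..s}"
    using s assms by (intro set_lebesgue_integral_eq_integral(1)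
        absolutely_integrable_on_subinterval[OF vi]) auto
  then have "integral {a..c} v + integral {c..s} v = integral {a..s} v"
    using s assms by (intro Henstock_Kurzweil_Integration.integral_combine) auto
  then show "y s = y c + integral {c..s} v"
    using y[of s] y[of c] s assms by (simp add: algebra_simps)
qed

text \<open>
  The dynamic programming inequality uses this to continue an arc \<open>y\<close> up to time \<open>b\<close> by another arc
  \<open>z\<close> that starts where \<open>y\<close> has arrived.
\<close>

lemma has_weak_derivative_on_paste:
  assumes v: "has_weak_derivative_on y v a b" and w: "has_weak_derivative_on z w b c"
    and yz: "z b = y b" and ab: "a \<le> b" "b \<le> c"
  shows "has_weak_derivative_on (\<lambda>s. if s \<le> b then y s else z s)
           (\<lambda>s. if s \<le> b then v s else w s) a c"
  unfolding has_weak_derivative_on_def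
proof (intro conjI ballI)
  have vi: "v absolutely_integrable_on {a..b}" and wi: "w absolutely_integrable_on {b..c}"
    and y: "\<And>s. s \<in> {a..b} \<Longrightarrow> y s = y a + integral {a..s} v"
    and z: "\<And>s. s \<in> {b..c} \<Longrightarrow> z s = z b + integral {b..s} w"
    using v w unfolding has_weak_derivative_on_def by blast+
  show "(\<lambda>s. if s \<le> b then v s else w s) absolutely_integrable_on {a..c}"
    by (rule absolutely_integrable_paste[OF vi wi ab])
  fix s assume s: "s \<in> {a..c}"
  show "(if s \<le> b then y s else z s) =
    (if a \<le> b then y a else z a) + integral {a..s} (\<lambda>s. if s \<le> b then v s else w s)"
  proof (cases "s \<le> b")
    case True
    have "integral {a..s} (\<lambda>s. if s \<le> b then v s else w s) = integral {a..s} v"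
      using True by (intro integral_cong) auto
    then show ?thesis using y[of s] True s ab by simp
  next
    case False
    have "w absolutely_integrable_on {b..s}"
      using absolutely_integrable_on_subinterval[OF wi] s by auto
    from integral_paste[OF vi this ab(1)] show ?thesis
      using False s ab y[of b] z[of s] yz by simp
  qed
qed

section \<open>Aumann integrals of cone-monotone maps\<close>

lemma convex_cone_simps:
  assumes "convex_cone C"
  shows convex_cone_0: "0 \<in> C" and convex_cone_plus: "C + C = C"
    and convex_cone_scale_ge: "\<And>x r. x \<in> C \<Longrightarrow> 0 \<le> r \<Longrightarrow> r *\<^sub>R x \<in> C"
proof -
  show 0: "0 \<in> C" using assms by (rule convex_cone_contains_0)
  have "C + C \<subseteq> C" using assms unfolding convex_cone_iff by (auto simp: set_plus_def)
  then show "C + C = C" using set_zero_plus2[OF 0, of C] by blast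
  show "\<And>x r. x \<in> C \<Longrightarrow> 0 \<le> r \<Longrightarrow> r *\<^sub>R x \<in> C"
    using assms unfolding convex_cone_iff by blast
qed

lemma aumann_integralI:
  assumes "f absolutely_integrable_on {a..b}" "AE s in lebesgue_on {a..b}. f s \<in> F s" "a \<noteq> b"
  shows "integral {a..b} f \<in> aumann_integral C a b F"
  using assms unfolding aumann_integral_def by auto

lemma aumann_integralE:
  assumes "x \<in> aumann_integral C a b F" "a \<noteq> b"
  obtains f where "x = integral {a..b} f" "f absolutely_integrable_on {a..b}"
    "AE s in lebesgue_on {a..b}. f s \<in> F s"
  using assms unfolding aumann_integral_def by auto

lemma aumann_integral_cong_AE:
  assumes "AE s in lebesgue_on {a..b}. F s = G s"
  shows "aumann_integral C a b F = aumann_integral C a b G"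
proof -
  have "(AE s in lebesgue_on {a..b}. f s \<in> F s) \<longleftrightarrow> (AE s in lebesgue_on {a..b}. f s \<in> G s)" for f
  proof
    assume "AE s in lebesgue_on {a..b}. f s \<in> F s"
    with assms show "AE s in lebesgue_on {a..b}. f s \<in> G s" by eventually_elim simp
  next
    assume "AE s in lebesgue_on {a..b}. f s \<in> G s"
    with assms show "AE s in lebesgue_on {a..b}. f s \<in> F s" by eventually_elim simp
  qed
  then show ?thesis unfolding aumann_integral_def by simp
qed

text \<open>
  A vector \<open>z\<close> of the cone is absorbed by spreading it evenly, adding \<open>z / (b - a)\<close> to a selection.
  On a degenerate interval the integral is \<open>C\<close> itself, and \<open>C + C = C\<close>.
\<close>

lemma aumann_integral_plus_cone:
  assumes C: "convex_cone C" and ab: "a \<le> b"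
    and F: "\<And>s x z. s \<in> {a..b} \<Longrightarrow> x \<in> F s \<Longrightarrow> z \<in> C \<Longrightarrow> x + z \<in> F s"
  shows "aumann_integral C a b F + C = aumann_integral C a b F"
proof (cases "a = b")
  case True
  then show ?thesis using convex_cone_plus[OF C] by (simp add: aumann_integral_def)
next
  case False
  have "integral {a..b} f + z \<in> aumann_integral C a b F"
    if f: "f absolutely_integrable_on {a..b}" "AE s in lebesgue_on {a..b}. f s \<in> F s" and z: "z \<in> C" for f z
  proof -
    define f' where "f' = (\<lambda>s. f s + (1 / (b - a)) *\<^sub>R z)"
    have z': "(1 / (b - a)) *\<^sub>R z \<in> C" using convex_cone_scale_ge[OF C z] ab by simp
    have const: "(\<lambda>s. (1 / (b - a)) *\<^sub>R z) absolutely_integrable_on {a..b}"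
      by (simp add: absolutely_integrable_continuous_real)
    have "f' absolutely_integrable_on {a..b}"
      unfolding f'_def using f(1) const by (rule set_integral_add(1))
    moreover have "integral {a..b} f' = integral {a..b} f + z"
      unfolding f'_def
      using f(1) const[THEN set_lebesgue_integral_eq_integral(1)] ab False
      by (simp add: Henstock_Kurzweil_Integration.integral_add set_lebesgue_integral_eq_integral(1))
    moreover have "AE s in lebesgue_on {a..b}. f' s \<in> F s"
      using f(2) F z' unfolding AE_lebesgue_on_Icc_iff f'_def by blast
    ultimately show ?thesis using aumann_integralI[where f = f' and F = F and C = C] False by metis
  qed
  then have "aumann_integral C a b F + C \<subseteq> aumann_integral C a b F"
    using False by (auto simp: set_plus_def aumann_integral_def)
  moreover have "aumann_integral C a b F \<subseteq> aumann_integral C a b F + C"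
    using set_zero_plus2[OF convex_cone_0[OF C], of "aumann_integral C a b F"] by (simp add: add.commute)
  ultimately show ?thesis by blast
qed

text \<open>
  Selections can be pasted and restricted.  The value \<open>C\<close> on degenerate intervals does not disturb
  additivity because the other integral absorbs \<open>C\<close>.
\<close>

lemma aumann_integral_combine:
  assumes C: "convex_cone C" and ab: "a \<le> b" "b \<le> c"
    and F: "\<And>s x z. s \<in> {a..c} \<Longrightarrow> x \<in> F s \<Longrightarrow> z \<in> C \<Longrightarrow> x + z \<in> F s"
  shows "aumann_integral C a b F + aumann_integral C b c F = aumann_integral C a c F"
proof -
  consider "a = b" | "b = c" | "a < b" "b < c" using ab by linarith
  then show ?thesis
  proof cases
    case 1
    then show ?thesis using aumann_integral_plus_cone[of C b c F] C ab F
      by (simp add: aumann_integral_def[of C b b] add.commute)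
  next
    case 2
    then show ?thesis using aumann_integral_plus_cone[of C a b F] C ab F
      by (simp add: aumann_integral_def[of C c c])
  next
    case 3
    show ?thesis
    proof (intro equalityI subsetI)
      fix x assume "x \<in> aumann_integral C a b F + aumann_integral C b c F"
      then obtain f g where x: "x = integral {a..b} f + integral {b..c} g"
        and f: "f absolutely_integrable_on {a..b}" "AE s in lebesgue_on {a..b}. f s \<in> F s"
        and g: "g absolutely_integrable_on {b..c}" "AE s in lebesgue_on {b..c}. g s \<in> F s"
        using 3 by (auto simp: set_plus_def aumann_integral_def)
      obtain N N' where "negligible N" "\<forall>s\<in>{a..b} - N. f s \<in> F s"
        "negligible N'" "\<forall>s\<in>{b..c} - N'. g s \<in> F s"
        using f(2) g(2) unfolding AE_lebesgue_on_Icc_iff by blast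
      then have "negligible (N \<union> N')"
        "\<forall>s\<in>{a..c} - (N \<union> N'). (if s \<le> b then f s else g s) \<in> F s"
        by auto
      then have "AE s in lebesgue_on {a..c}. (if s \<le> b then f s else g s) \<in> F s"
        unfolding AE_lebesgue_on_Icc_iff by blast
      from aumann_integralI[OF absolutely_integrable_paste[OF f(1) g(1) ab] this, where C = C]
      show "x \<in> aumann_integral C a c F"
        using integral_paste[OF f(1) g(1) ab] 3 x by simp
    next
      fix x assume "x \<in> aumann_integral C a c F"
      then obtain f where x: "x = integral {a..c} f"
        and f: "f absolutely_integrable_on {a..c}" "AE s in lebesgue_on {a..c}. f s \<in> F s"
        using 3 by (auto simp: aumann_integral_def)
      have sub: "{a..b} \<subseteq> {a..c}" "{b..c} \<subseteq> {a..c}" using 3 by auto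
      have "integral {a..b} f \<in> aumann_integral C a b F" "integral {b..c} f \<in> aumann_integral C b c F"
        using absolutely_integrable_on_subinterval[OF f(1) sub(1)] AE_lebesgue_on_subinterval[OF f(2) sub(1)]
          absolutely_integrable_on_subinterval[OF f(1) sub(2)] AE_lebesgue_on_subinterval[OF f(2) sub(2)] 3
        by (auto intro: aumann_integralI)
      moreover have "x = integral {a..b} f + integral {b..c} f"
        using Henstock_Kurzweil_Integration.integral_combine[OF ab set_lebesgue_integral_eq_integral(1)[OF f(1)]] x
        by simp
      ultimately show "x \<in> aumann_integral C a b F + aumann_integral C b c F" by blast
    qed
  qed
qed

lemma aumann_integral_translate_subset:
  assumes w: "w absolutely_integrable_on {a..b}"
  shows "integral {a..b} w +o aumann_integral C a b F \<subseteq> aumann_integral C a b (\<lambda>s. w s +o F s)"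
proof (cases "a = b")
  case True
  then show ?thesis by (simp add: aumann_integral_def)
next
  case False
  show ?thesis
  proof
    fix x assume "x \<in> integral {a..b} w +o aumann_integral C a b F"
    then obtain f where x: "x = integral {a..b} w + integral {a..b} f"
      and f: "f absolutely_integrable_on {a..b}" "AE s in lebesgue_on {a..b}. f s \<in> F s"
      using False by (auto simp: aumann_integral_def elt_set_plus_def)
    have "(\<lambda>s. w s + f s) absolutely_integrable_on {a..b}"
      using w f(1) by (rule set_integral_add(1))
    moreover have "x = integral {a..b} (\<lambda>s. w s + f s)"
      unfolding x using w f(1)
      by (simp add: Henstock_Kurzweil_Integration.integral_add set_lebesgue_integral_eq_integral(1))
    moreover have "AE s in lebesgue_on {a..b}. w s + f s \<in> w s +o F s"
      using f(2) by eventually_elim auto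
    ultimately show "x \<in> aumann_integral C a b (\<lambda>s. w s +o F s)"
      using False unfolding aumann_integral_def by auto
  qed
qed

text \<open>
  Translating by \<open>- w\<close> undoes translating by \<open>w\<close>, so the inclusion already known is an equality.
\<close>

lemma aumann_integral_translate:
  assumes w: "w absolutely_integrable_on {a..b}"
  shows "aumann_integral C a b (\<lambda>s. w s +o F s) = integral {a..b} w +o aumann_integral C a b F"
proof (rule equalityI[OF _ aumann_integral_translate_subset[OF w]])
  have "(\<lambda>s. - w s) absolutely_integrable_on {a..b}"
    using w unfolding set_integrable_def by simp
  from aumann_integral_translate_subset[OF this, of C "\<lambda>s. w s +o F s"]
  have "(- integral {a..b} w) +o aumann_integral C a b (\<lambda>s. w s +o F s) \<subseteq> aumann_integral C a b F"
    by (simp add: set_plus_rearrange2)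
  then have "integral {a..b} w +o ((- integral {a..b} w) +o aumann_integral C a b (\<lambda>s. w s +o F s))
      \<subseteq> integral {a..b} w +o aumann_integral C a b F"
    by (rule set_plus_mono)
  then show "aumann_integral C a b (\<lambda>s. w s +o F s) \<subseteq> integral {a..b} w +o aumann_integral C a b F"
    by (simp add: set_plus_rearrange2)
qed

section \<open>The epigraph of the Lagrangian with respect to the cone\<close>

text \<open>
  The bipolar theorem for \<open>C\<close>, tested on a base of the dual cone only.  It turns hypotheses on the
  scalarizations by elements of \<open>B\<close> into statements about \<open>C\<close>.
\<close>

lemma mem_cone_iff_base:
  fixes C B :: "'a::euclidean_space set"
  assumes C: "convex_cone C" "closed C" and B: "is_base B (pos_dual C)"
  shows "z \<in> C \<longleftrightarrow> (\<forall>\<zeta>\<in>B. 0 \<le> z \<bullet> \<zeta>)"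
proof
  assume "z \<in> C"
  then show "\<forall>\<zeta>\<in>B. 0 \<le> z \<bullet> \<zeta>"
    using B unfolding is_base_def pos_dual_def by (auto simp: inner_commute)
next
  assume z: "\<forall>\<zeta>\<in>B. 0 \<le> z \<bullet> \<zeta>"
  show "z \<in> C"
  proof (rule ccontr)
    assume "z \<notin> C"
    moreover have "convex C" using C(1) by (simp add: convex_cone_def)
    ultimately obtain n \<beta> where n: "n \<bullet> z < \<beta>" "\<And>x. x \<in> C \<Longrightarrow> \<beta> < n \<bullet> x"
      using separating_hyperplane_closed_point[of C z] C(2) by blast
    have "\<beta> < 0" using n(2)[OF convex_cone_0[OF C(1)]] by simp
    have "n \<in> pos_dual C" unfolding pos_dual_def
    proof (intro CollectI ballI leI notI)
      fix x assume x: "x \<in> C" and neg: "n \<bullet> x < 0"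
      \<comment> \<open>The separating bound fails far out on the ray through \<open>x\<close>, where the functional takes the value \<open>\<beta>\<close>.\<close>
      have "(\<beta> / (n \<bullet> x)) *\<^sub>R x \<in> C"
        using convex_cone_scale_ge[OF C(1) x] neg \<open>\<beta> < 0\<close> by (simp add: divide_nonpos_neg)
      from n(2)[OF this] show False using neg by simp
    qed
    moreover have "n \<noteq> 0" using n(1) \<open>\<beta> < 0\<close> by auto
    ultimately obtain c \<xi> where "0 < c" "\<xi> \<in> B" "n = c *\<^sub>R \<xi>"
      using B unfolding is_base_def by blast
    then have "0 \<le> n \<bullet> z" using z by (simp add: inner_commute)
    then show False using n(1) \<open>\<beta> < 0\<close> by simp
  qed
qed

text \<open>
  For the order \<open>z \<le> z' \<longleftrightarrow> z' - z \<in> C\<close> this is the ordinary epigraph of the vector-valued map \<open>L\<close>.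
\<close>

definition cone_epigraph :: "'b::ab_group_add set \<Rightarrow> ('a \<Rightarrow> 'b) \<Rightarrow> ('a \<times> 'b) set" where
  "cone_epigraph C L = {(w, z). z - L w \<in> C}"

text \<open>
  Since \<open>C\<close> is cut out by the functionals in \<open>B\<close>, the epigraph is the intersection of the
  epigraphs of the scalarizations, each of which is convex and closed.
\<close>

lemma
  fixes C B :: "'b::euclidean_space set" and L :: "'a::euclidean_space \<Rightarrow> 'b"
  assumes C: "convex_cone C" "closed C" and B: "is_base B (pos_dual C)"
    and conv: "\<And>\<zeta>. \<zeta> \<in> B \<Longrightarrow> convex_on UNIV (\<lambda>w. L w \<bullet> \<zeta>)"
    and cont: "\<And>\<zeta>. \<zeta> \<in> B \<Longrightarrow> continuous_on UNIV (\<lambda>w. L w \<bullet> \<zeta>)"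
  shows convex_cone_epigraph: "convex (cone_epigraph C L)"
    and closed_cone_epigraph: "closed (cone_epigraph C L)"
proof -
  have eq: "cone_epigraph C L = (\<Inter>\<zeta>\<in>B. {p. L (fst p) \<bullet> \<zeta> \<le> snd p \<bullet> \<zeta>})"
    unfolding cone_epigraph_def mem_cone_iff_base[OF C B] by (auto simp: inner_diff_left)
  show "convex (cone_epigraph C L)" unfolding eq
  proof (rule convex_INT)
    fix \<zeta> assume \<zeta>: "\<zeta> \<in> B"
    show "convex {p. L (fst p) \<bullet> \<zeta> \<le> snd p \<bullet> \<zeta>}"
    proof (rule convexI)
      fix p q u v
      assume p: "p \<in> {p. L (fst p) \<bullet> \<zeta> \<le> snd p \<bullet> \<zeta>}" and q: "q \<in> {p. L (fst p) \<bullet> \<zeta> \<le> snd p \<bullet> \<zeta>}"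
        and uv: "0 \<le> (u::real)" "0 \<le> v" "u + v = 1"
      have "L (u *\<^sub>R fst p + v *\<^sub>R fst q) \<bullet> \<zeta> \<le> u * (L (fst p) \<bullet> \<zeta>) + v * (L (fst q) \<bullet> \<zeta>)"
        using conv[OF \<zeta>] uv unfolding convex_on_def by blast
      also have "\<dots> \<le> u * (snd p \<bullet> \<zeta>) + v * (snd q \<bullet> \<zeta>)"
        using p q uv by (intro add_mono mult_left_mono) auto
      finally show "u *\<^sub>R p + v *\<^sub>R q \<in> {p. L (fst p) \<bullet> \<zeta> \<le> snd p \<bullet> \<zeta>}"
        by (simp add: inner_add_left)
    qed
  qed
  show "closed (cone_epigraph C L)" unfolding eq
  proof (intro closed_INT ballI closed_Collect_le)
    fix \<zeta> assume \<zeta>: "\<zeta> \<in> B"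
    show "continuous_on UNIV (\<lambda>p. L (fst p) \<bullet> \<zeta>)"
      by (rule continuous_on_compose2[OF cont[OF \<zeta>]]) (auto intro: continuous_intros)
  qed (intro continuous_intros)
qed

lemma strictly_convex_imp_convex_on:
  assumes "strictly_convex f"
  shows "convex_on UNIV f"
proof (intro convex_onI)
  fix t :: real and x y assume t: "0 < t" "t < 1"
  show "f ((1 - t) *\<^sub>R x + t *\<^sub>R y) \<le> (1 - t) * f x + t * f y"
  proof (cases "x = y")
    case True
    then show ?thesis by (simp flip: scaleR_add_left distrib_right)
  next
    case False
    then have "f (t *\<^sub>R y + (1 - t) *\<^sub>R x) < t * f y + (1 - t) * f x"
      using assms t unfolding strictly_convex_def by auto
    then show ?thesis by (simp add: add.commute)
  qed
qed simp

lemma C2_fun_imp_continuous_on: "C2_fun f \<Longrightarrow> continuous_on UNIV f"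
  unfolding C2_fun_def by (metis has_derivative_continuous continuous_at_imp_continuous_on)

section \<open>Approximation by piecewise constant velocities\<close>

lemma has_integral_Pair:
  fixes f :: "'c::euclidean_space \<Rightarrow> 'a::euclidean_space" and g :: "'c \<Rightarrow> 'b::euclidean_space"
  assumes "(f has_integral i) S" "(g has_integral j) S"
  shows "((\<lambda>s. (f s, g s)) has_integral (i, j)) S"
proof -
  have "bounded_linear (\<lambda>x :: 'a. (x, 0 :: 'b))" "bounded_linear (\<lambda>x :: 'b. (0 :: 'a, x))"
    by (intro bounded_linear_Pair bounded_linear_ident bounded_linear_zero)+
  from has_integral_add[OF has_integral_linear[OF assms(1) this(1)] has_integral_linear[OF assms(2) this(2)]]
  show ?thesis by (simp add: o_def)
qed

text \<open>
  The velocity \<open>v\<close> with its cost selection \<open>f\<close> is replaced by a piecewise constant velocity \<open>u\<close> with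
  nearly the same cost and the same displacement.  For such \<open>u\<close> the composition \<open>L \<circ> u\<close> is a step
  function, hence integrable against every continuous weight, even where \<open>L \<circ> v\<close> fails to be
  integrable; this can happen in the directions \<open>C \<inter> - C\<close>, along which nothing is known of \<open>L\<close>.

  Dividing by the discount, \<open>(v, f / \<delta>)\<close> lies almost everywhere in the convex closed epigraph, and so
  does its average \<open>(w, z)\<close> over any interval.  Thus \<open>u = w\<close> admits the selection \<open>\<delta> z\<close>.  Were \<open>\<delta>\<close>
  constant, the integral of \<open>\<delta> z\<close> over the interval would equal that of \<open>f\<close>; in general the difference
  is bounded by the oscillation of \<open>\<delta>\<close> times the integral of \<open>|f / \<delta>|\<close>.  This bound is additive over
  adjacent intervals, so the local construction is globalized by bisection instead of an
  explicit partition.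
\<close>

lemma piecewise_constant_velocity_approximation:
  fixes C :: "'b::euclidean_space set" and L :: "'a::euclidean_space \<Rightarrow> 'b"
    and \<delta> :: "real \<Rightarrow> real" and v :: "real \<Rightarrow> 'a"
  assumes C: "convex_cone C" and epi: "convex (cone_epigraph C L)" "closed (cone_epigraph C L)"
    and ab: "a \<le> b" and \<delta>: "continuous_on {a..b} \<delta>" "\<And>s. s \<in> {a..b} \<Longrightarrow> 0 < \<delta> s"
    and v: "v absolutely_integrable_on {a..b}" and f: "f absolutely_integrable_on {a..b}"
    and fv: "AE s in lebesgue_on {a..b}. f s \<in> (\<delta> s *\<^sub>R L (v s)) +o C"
    and e: "0 < e"
  obtains u p where "u absolutely_integrable_on {a..b}" "integral {a..b} u = integral {a..b} v"
    and "\<And>k. continuous_on {a..b} k \<Longrightarrow> (\<lambda>s. k s *\<^sub>R L (u s)) absolutely_integrable_on {a..b}"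
    and "p absolutely_integrable_on {a..b}" "\<And>s. s \<in> {a..b} \<Longrightarrow> p s \<in> (\<delta> s *\<^sub>R L (u s)) +o C"
    and "norm (integral {a..b} p - integral {a..b} f) \<le> e"
proof -
  define \<phi> where "\<phi> = (\<lambda>s. (1 / \<delta> s) *\<^sub>R f s)"
  have "continuous_on {a..b} (\<lambda>s. 1 / \<delta> s)"
    using \<delta> by (intro continuous_intros) force+
  from absolutely_integrable_continuous_scaleR[OF this f]
  have \<phi>: "\<phi> absolutely_integrable_on {a..b}" unfolding \<phi>_def .
  have f_eq: "f s = \<delta> s *\<^sub>R \<phi> s" if "s \<in> {a..b}" for s
    using \<delta>(2)[OF that] by (simp add: \<phi>_def)
  have mem: "AE s in lebesgue_on {a..b}. (v s, \<phi> s) \<in> cone_epigraph C L"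
  proof -
    obtain N where N: "negligible N" "\<And>s. s \<in> {a..b} - N \<Longrightarrow> f s \<in> (\<delta> s *\<^sub>R L (v s)) +o C"
      using fv unfolding AE_lebesgue_on_Icc_iff by blast
    have "(v s, \<phi> s) \<in> cone_epigraph C L" if s: "s \<in> {a..b} - N" for s
    proof -
      have "f s - \<delta> s *\<^sub>R L (v s) \<in> C" using N(2)[OF s] by (rule set_plus_imp_minus)
      from convex_cone_scale_ge[OF C this, of "1 / \<delta> s"] show ?thesis
        using \<delta>(2)[of s] s by (simp add: cone_epigraph_def \<phi>_def scaleR_diff_right)
    qed
    with N(1) show ?thesis unfolding AE_lebesgue_on_Icc_iff by blast
  qed
  define I where "I = integral {a..b} (\<lambda>s. norm (\<phi> s))"
  have "(\<lambda>s. norm (\<phi> s)) integrable_on {a..b}"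
    using \<phi> unfolding absolutely_integrable_on_def by blast
  then have "0 \<le> I" unfolding I_def by (intro Henstock_Kurzweil_Integration.integral_nonneg) auto
  \<comment> \<open>With \<open>1 + I\<close> in the denominator, the total error \<open>2 \<epsilon> I\<close> stays below \<open>e\<close>, also when \<open>I = 0\<close>.\<close>
  define \<epsilon> where "\<epsilon> = e / (2 * (1 + I))"
  have \<epsilon>: "0 < \<epsilon>" using e \<open>0 \<le> I\<close> by (simp add: \<epsilon>_def)
  define P where "P \<alpha> \<beta> \<longleftrightarrow> ({\<alpha>..\<beta>} \<subseteq> {a..b} \<longrightarrow> (\<exists>u p. u absolutely_integrable_on {\<alpha>..\<beta>} \<and>
      integral {\<alpha>..\<beta>} u = integral {\<alpha>..\<beta>} v \<and>
      (\<forall>k. continuous_on {\<alpha>..\<beta>} k \<longrightarrow> (\<lambda>s. k s *\<^sub>R L (u s)) absolutely_integrable_on {\<alpha>..\<beta>}) \<and>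
      p absolutely_integrable_on {\<alpha>..\<beta>} \<and> (\<forall>s\<in>{\<alpha>..\<beta>}. p s \<in> (\<delta> s *\<^sub>R L (u s)) +o C) \<and>
      norm (integral {\<alpha>..\<beta>} p - integral {\<alpha>..\<beta>} f) \<le> 2 * \<epsilon> * integral {\<alpha>..\<beta>} (\<lambda>s. norm (\<phi> s))))"
    for \<alpha> \<beta>
  have "P a b" using ab
  proof (induction rule: Bolzano)
    case (trans \<alpha> \<beta> \<gamma>)
    note le = trans(3,4)
    show ?case unfolding P_def
    proof
      assume sub: "{\<alpha>..\<gamma>} \<subseteq> {a..b}"
      then have sub1: "{\<alpha>..\<beta>} \<subseteq> {a..b}" and sub2: "{\<beta>..\<gamma>} \<subseteq> {a..b}" using le by auto
      obtain u p where u: "u absolutely_integrable_on {\<alpha>..\<beta>}" "integral {\<alpha>..\<beta>} u = integral {\<alpha>..\<beta>} v"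
        and k: "\<And>k. continuous_on {\<alpha>..\<beta>} k \<Longrightarrow> (\<lambda>s. k s *\<^sub>R L (u s)) absolutely_integrable_on {\<alpha>..\<beta>}"
        and p: "p absolutely_integrable_on {\<alpha>..\<beta>}" "\<And>s. s \<in> {\<alpha>..\<beta>} \<Longrightarrow> p s \<in> (\<delta> s *\<^sub>R L (u s)) +o C"
        and n: "norm (integral {\<alpha>..\<beta>} p - integral {\<alpha>..\<beta>} f) \<le> 2 * \<epsilon> * integral {\<alpha>..\<beta>} (\<lambda>s. norm (\<phi> s))"
        using trans(1) sub1 unfolding P_def by blast
      obtain u' p' where u': "u' absolutely_integrable_on {\<beta>..\<gamma>}" "integral {\<beta>..\<gamma>} u' = integral {\<beta>..\<gamma>} v"
        and k': "\<And>k. continuous_on {\<beta>..\<gamma>} k \<Longrightarrow> (\<lambda>s. k s *\<^sub>R L (u' s)) absolutely_integrable_on {\<beta>..\<gamma>}"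
        and p': "p' absolutely_integrable_on {\<beta>..\<gamma>}" "\<And>s. s \<in> {\<beta>..\<gamma>} \<Longrightarrow> p' s \<in> (\<delta> s *\<^sub>R L (u' s)) +o C"
        and n': "norm (integral {\<beta>..\<gamma>} p' - integral {\<beta>..\<gamma>} f) \<le> 2 * \<epsilon> * integral {\<beta>..\<gamma>} (\<lambda>s. norm (\<phi> s))"
        using trans(2) sub2 unfolding P_def by blast
      let ?u = "\<lambda>s. if s \<le> \<beta> then u s else u' s"
      let ?p = "\<lambda>s. if s \<le> \<beta> then p s else p' s"
      have split: "integral {\<alpha>..\<gamma>} h = integral {\<alpha>..\<beta>} h + integral {\<beta>..\<gamma>} h"
        if "h absolutely_integrable_on {a..b}" for h :: "real \<Rightarrow> 'c::euclidean_space"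
        using Henstock_Kurzweil_Integration.integral_combine[OF le, of h]
          set_lebesgue_integral_eq_integral(1)[OF absolutely_integrable_on_subinterval[OF that sub]]
        by simp
      have n\<phi>: "(\<lambda>s. norm (\<phi> s)) absolutely_integrable_on {a..b}"
        using \<phi> by (rule absolutely_integrable_norm[unfolded o_def])
      show "\<exists>u p. u absolutely_integrable_on {\<alpha>..\<gamma>} \<and>
        integral {\<alpha>..\<gamma>} u = integral {\<alpha>..\<gamma>} v \<and>
        (\<forall>k. continuous_on {\<alpha>..\<gamma>} k \<longrightarrow> (\<lambda>s. k s *\<^sub>R L (u s)) absolutely_integrable_on {\<alpha>..\<gamma>}) \<and>
        p absolutely_integrable_on {\<alpha>..\<gamma>} \<and> (\<forall>s\<in>{\<alpha>..\<gamma>}. p s \<in> (\<delta> s *\<^sub>R L (u s)) +o C) \<and>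
        norm (integral {\<alpha>..\<gamma>} p - integral {\<alpha>..\<gamma>} f) \<le> 2 * \<epsilon> * integral {\<alpha>..\<gamma>} (\<lambda>s. norm (\<phi> s))"
      proof (rule exI[of _ ?u], rule exI[of _ ?p], intro conjI allI impI ballI)
        show "?u absolutely_integrable_on {\<alpha>..\<gamma>}" "?p absolutely_integrable_on {\<alpha>..\<gamma>}"
          by (rule absolutely_integrable_paste; fact)+
        show "integral {\<alpha>..\<gamma>} ?u = integral {\<alpha>..\<gamma>} v"
          unfolding integral_paste[OF u(1) u'(1) le] split[OF v] u(2) u'(2) ..
        show "?p s \<in> (\<delta> s *\<^sub>R L (?u s)) +o C" if "s \<in> {\<alpha>..\<gamma>}" for s
          using that p(2) p'(2) by auto
        show "(\<lambda>s. k s *\<^sub>R L (?u s)) absolutely_integrable_on {\<alpha>..\<gamma>}" if "continuous_on {\<alpha>..\<gamma>} k" for k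
        proof -
          have "continuous_on {\<alpha>..\<beta>} k" "continuous_on {\<beta>..\<gamma>} k"
            using that le by (auto elim: continuous_on_subset)
          from absolutely_integrable_paste[OF k[OF this(1)] k'[OF this(2)] le]
          show ?thesis by (rule set_integrable_cong[THEN iffD1, rotated -1]) auto
        qed
        have "integral {\<alpha>..\<gamma>} ?p - integral {\<alpha>..\<gamma>} f =
          (integral {\<alpha>..\<beta>} p - integral {\<alpha>..\<beta>} f) + (integral {\<beta>..\<gamma>} p' - integral {\<beta>..\<gamma>} f)"
          unfolding integral_paste[OF p(1) p'(1) le] split[OF f] by simp
        then have "norm (integral {\<alpha>..\<gamma>} ?p - integral {\<alpha>..\<gamma>} f) \<le>
          norm (integral {\<alpha>..\<beta>} p - integral {\<alpha>..\<beta>} f) + norm (integral {\<beta>..\<gamma>} p' - integral {\<beta>..\<gamma>} f)"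
          by (simp only: norm_triangle_ineq)
        also have "\<dots> \<le> 2 * \<epsilon> * integral {\<alpha>..\<beta>} (\<lambda>s. norm (\<phi> s)) + 2 * \<epsilon> * integral {\<beta>..\<gamma>} (\<lambda>s. norm (\<phi> s))"
          using n n' by (rule add_mono)
        also have "\<dots> = 2 * \<epsilon> * integral {\<alpha>..\<gamma>} (\<lambda>s. norm (\<phi> s))"
          unfolding split[OF n\<phi>] by (simp add: algebra_simps)
        finally show "norm (integral {\<alpha>..\<gamma>} ?p - integral {\<alpha>..\<gamma>} f) \<le> \<dots>" .
      qed
    qed
  next
    case (local x)
    then have x: "x \<in> {a..b}" by simp
    obtain r where r: "0 < r" "\<And>s. s \<in> {a..b} \<Longrightarrow> dist s x < r \<Longrightarrow> dist (\<delta> s) (\<delta> x) < \<epsilon>"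
      using \<delta>(1)[unfolded continuous_on_iff, rule_format, OF x \<epsilon>] by blast
    have "P \<alpha> \<beta>" if xx: "\<alpha> \<le> x" "x \<le> \<beta>" "\<beta> - \<alpha> < r" for \<alpha> \<beta>
      unfolding P_def
    proof
      assume sub: "{\<alpha>..\<beta>} \<subseteq> {a..b}"
      show "\<exists>u p. u absolutely_integrable_on {\<alpha>..\<beta>} \<and>
        integral {\<alpha>..\<beta>} u = integral {\<alpha>..\<beta>} v \<and>
        (\<forall>k. continuous_on {\<alpha>..\<beta>} k \<longrightarrow> (\<lambda>s. k s *\<^sub>R L (u s)) absolutely_integrable_on {\<alpha>..\<beta>}) \<and>
        p absolutely_integrable_on {\<alpha>..\<beta>} \<and> (\<forall>s\<in>{\<alpha>..\<beta>}. p s \<in> (\<delta> s *\<^sub>R L (u s)) +o C) \<and>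
        norm (integral {\<alpha>..\<beta>} p - integral {\<alpha>..\<beta>} f) \<le> 2 * \<epsilon> * integral {\<alpha>..\<beta>} (\<lambda>s. norm (\<phi> s))"
      proof -
        define l where "l = \<beta> - \<alpha>"
        define w where "w = (1 / l) *\<^sub>R integral {\<alpha>..\<beta>} v"
        \<comment> \<open>On a one-point interval the average is meaningless, and \<open>L w\<close> keeps the pair in the epigraph.\<close>
        define z where "z = (if \<alpha> = \<beta> then L w else (1 / l) *\<^sub>R integral {\<alpha>..\<beta>} \<phi>)"
        have vs: "v absolutely_integrable_on {\<alpha>..\<beta>}" and \<phi>s: "\<phi> absolutely_integrable_on {\<alpha>..\<beta>}"
          using absolutely_integrable_on_subinterval[OF _ sub] v \<phi> by auto
        note vi = set_lebesgue_integral_eq_integral(1)[OF vs]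
        note \<phi>i = set_lebesgue_integral_eq_integral(1)[OF \<phi>s]
        have l: "0 \<le> l" using xx by (simp add: l_def)
        have wv: "l *\<^sub>R w = integral {\<alpha>..\<beta>} v" and z\<phi>: "l *\<^sub>R z = integral {\<alpha>..\<beta>} \<phi>"
          using xx by (auto simp: w_def z_def l_def)
        have wz: "z - L w \<in> C"
        proof (cases "\<alpha> = \<beta>")
          case True
          then show ?thesis using convex_cone_0[OF C] by (simp add: z_def)
        next
          case False
          then have "\<alpha> < \<beta>" using xx by simp
          have "((\<lambda>s. (v s, \<phi> s)) has_integral (integral {\<alpha>..\<beta>} v, integral {\<alpha>..\<beta>} \<phi>)) {\<alpha>..\<beta>}"
            by (intro has_integral_Pair integrable_integral vi \<phi>i)
          then have pi: "(\<lambda>s. (v s, \<phi> s)) integrable_on {\<alpha>..\<beta>}"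
            "integral {\<alpha>..\<beta>} (\<lambda>s. (v s, \<phi> s)) = (integral {\<alpha>..\<beta>} v, integral {\<alpha>..\<beta>} \<phi>)"
            by (auto simp: has_integral_integrable_integral)
          have "(1 / (\<beta> - \<alpha>)) *\<^sub>R integral {\<alpha>..\<beta>} (\<lambda>s. (v s, \<phi> s)) \<in> cone_epigraph C L"
            by (rule average_in_closed_convex[OF epi \<open>\<alpha> < \<beta>\<close> pi(1) AE_lebesgue_on_subinterval[OF mem sub]])
          then show ?thesis using False pi(2) by (simp add: cone_epigraph_def w_def z_def l_def)
        qed
        have \<delta>c: "continuous_on {\<alpha>..\<beta>} \<delta>" using \<delta>(1) sub by (rule continuous_on_subset)
        have osc: "\<bar>\<delta> s - \<delta> x\<bar> \<le> \<epsilon>" if "s \<in> {\<alpha>..\<beta>}" for s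
          using r(2)[of s] that xx sub by (auto simp: dist_real_def intro!: less_imp_le)
        have pint: "(\<lambda>s. \<delta> s *\<^sub>R z) absolutely_integrable_on {\<alpha>..\<beta>}"
          by (intro absolutely_integrable_continuous_real continuous_intros \<delta>c)
        \<comment> \<open>The constant part \<open>\<delta> x\<close> of the discount contributes equally to both integrals; only the variation \<open>D\<close> matters.\<close>
        define D where "D = (\<lambda>s. \<delta> s - \<delta> x)"
        have Dc: "continuous_on {\<alpha>..\<beta>} D" unfolding D_def by (intro continuous_intros \<delta>c)
        have Dz: "(\<lambda>s. D s *\<^sub>R z) integrable_on {\<alpha>..\<beta>}"
          by (intro integrable_continuous_real continuous_intros Dc)
        have D\<phi>: "(\<lambda>s. D s *\<^sub>R \<phi> s) integrable_on {\<alpha>..\<beta>}"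
          by (rule set_lebesgue_integral_eq_integral(1)[OF absolutely_integrable_continuous_scaleR[OF Dc \<phi>s]])
        have n\<phi>: "(\<lambda>s. norm (\<phi> s)) integrable_on {\<alpha>..\<beta>}"
          using \<phi>s by (simp add: absolutely_integrable_on_def)
        have const_i: "((\<lambda>s. c) has_integral l *\<^sub>R c) {\<alpha>..\<beta>}" for c :: "'c::euclidean_space"
          using has_integral_const_real[of c \<alpha> \<beta>] xx by (simp add: l_def)
        have "integral {\<alpha>..\<beta>} (\<lambda>s. \<delta> s *\<^sub>R z) = integral {\<alpha>..\<beta>} (\<lambda>s. D s *\<^sub>R z + \<delta> x *\<^sub>R z)"
          by (simp add: D_def scaleR_diff_left)
        also have "\<dots> = integral {\<alpha>..\<beta>} (\<lambda>s. D s *\<^sub>R z) + \<delta> x *\<^sub>R (l *\<^sub>R z)"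
          using Henstock_Kurzweil_Integration.integral_add[OF Dz has_integral_integrable[OF const_i[of "\<delta> x *\<^sub>R z"]]]
          by (simp only: integral_unique[OF const_i] scaleR_left_commute)
        finally have ip: "integral {\<alpha>..\<beta>} (\<lambda>s. \<delta> s *\<^sub>R z) = \<dots>" .
        have "integral {\<alpha>..\<beta>} f = integral {\<alpha>..\<beta>} (\<lambda>s. D s *\<^sub>R \<phi> s + \<delta> x *\<^sub>R \<phi> s)"
          using sub by (intro integral_cong) (auto simp: D_def scaleR_diff_left f_eq)
        also have "\<dots> = integral {\<alpha>..\<beta>} (\<lambda>s. D s *\<^sub>R \<phi> s) + \<delta> x *\<^sub>R integral {\<alpha>..\<beta>} \<phi>"
          using Henstock_Kurzweil_Integration.integral_add[OF D\<phi> integrable_cmul[OF \<phi>i]] by simp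
        finally have if': "integral {\<alpha>..\<beta>} f = \<dots>" .
        have "norm (integral {\<alpha>..\<beta>} (\<lambda>s. D s *\<^sub>R z)) \<le> integral {\<alpha>..\<beta>} (\<lambda>s. \<epsilon> * norm z)"
          using osc by (intro integral_norm_bound_integral Dz has_integral_integrable[OF const_i])
             (auto simp: D_def intro: mult_right_mono)
        also have "\<dots> = \<epsilon> * norm (l *\<^sub>R z)"
          using l by (simp only: integral_unique[OF const_i]) simp
        also have "\<dots> \<le> \<epsilon> * integral {\<alpha>..\<beta>} (\<lambda>s. norm (\<phi> s))"
          unfolding z\<phi> using \<epsilon> by (intro mult_left_mono integral_norm_bound_integral \<phi>i n\<phi>) auto
        finally have b1: "norm (integral {\<alpha>..\<beta>} (\<lambda>s. D s *\<^sub>R z)) \<le> \<dots>" .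
        have "norm (integral {\<alpha>..\<beta>} (\<lambda>s. D s *\<^sub>R \<phi> s)) \<le> integral {\<alpha>..\<beta>} (\<lambda>s. \<epsilon> * norm (\<phi> s))"
          using osc n\<phi> by (intro integral_norm_bound_integral D\<phi> integrable_on_mult_right)
             (auto simp: D_def intro: mult_right_mono)
        then have b2: "norm (integral {\<alpha>..\<beta>} (\<lambda>s. D s *\<^sub>R \<phi> s)) \<le> \<epsilon> * integral {\<alpha>..\<beta>} (\<lambda>s. norm (\<phi> s))"
          by simp
        show ?thesis
        proof (rule exI[of _ "\<lambda>s. w"], rule exI[of _ "\<lambda>s. \<delta> s *\<^sub>R z"], intro conjI allI impI ballI)
          show "(\<lambda>s. w) absolutely_integrable_on {\<alpha>..\<beta>}"
            by (simp add: absolutely_integrable_continuous_real)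
          show "integral {\<alpha>..\<beta>} (\<lambda>s. w) = integral {\<alpha>..\<beta>} v"
            by (simp only: integral_unique[OF const_i] wv)
          show "(\<lambda>s. k s *\<^sub>R L w) absolutely_integrable_on {\<alpha>..\<beta>}" if "continuous_on {\<alpha>..\<beta>} k" for k
            using that by (intro absolutely_integrable_continuous_real continuous_intros)
          show "(\<lambda>s. \<delta> s *\<^sub>R z) absolutely_integrable_on {\<alpha>..\<beta>}" by (rule pint)
          show "\<delta> s *\<^sub>R z \<in> (\<delta> s *\<^sub>R L w) +o C" if "s \<in> {\<alpha>..\<beta>}" for s
          proof (rule set_minus_imp_plus)
            have "0 < \<delta> s" using \<delta>(2) that sub by blast
            then show "\<delta> s *\<^sub>R z - \<delta> s *\<^sub>R L w \<in> C"
              using convex_cone_scale_ge[OF C wz, of "\<delta> s"] by (simp add: scaleR_diff_right)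
          qed
          have "integral {\<alpha>..\<beta>} (\<lambda>s. \<delta> s *\<^sub>R z) - integral {\<alpha>..\<beta>} f =
            integral {\<alpha>..\<beta>} (\<lambda>s. D s *\<^sub>R z) - integral {\<alpha>..\<beta>} (\<lambda>s. D s *\<^sub>R \<phi> s)"
            unfolding ip if' z\<phi> by simp
          then show "norm (integral {\<alpha>..\<beta>} (\<lambda>s. \<delta> s *\<^sub>R z) - integral {\<alpha>..\<beta>} f)
            \<le> 2 * \<epsilon> * integral {\<alpha>..\<beta>} (\<lambda>s. norm (\<phi> s))"
            using b1 b2 norm_triangle_ineq4[of "integral {\<alpha>..\<beta>} (\<lambda>s. D s *\<^sub>R z)" "integral {\<alpha>..\<beta>} (\<lambda>s. D s *\<^sub>R \<phi> s)"]
            by simp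
        qed
      qed
    qed
    with r(1) show ?case by blast
  qed
  then obtain u p where up: "u absolutely_integrable_on {a..b}" "integral {a..b} u = integral {a..b} v"
    "\<And>k. continuous_on {a..b} k \<Longrightarrow> (\<lambda>s. k s *\<^sub>R L (u s)) absolutely_integrable_on {a..b}"
    "p absolutely_integrable_on {a..b}" "\<And>s. s \<in> {a..b} \<Longrightarrow> p s \<in> (\<delta> s *\<^sub>R L (u s)) +o C"
    and bound: "norm (integral {a..b} p - integral {a..b} f) \<le> 2 * \<epsilon> * I"
    unfolding P_def I_def by blast
  have "2 * \<epsilon> * I \<le> e" using e \<open>0 \<le> I\<close> by (simp add: \<epsilon>_def field_simps)
  with bound up that show thesis by (meson order_trans)
qed

section \<open>The dynamic programming principle\<close>

lemma set_lagrangian_absorbs_cone: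
  assumes "convex_cone C" "x \<in> set_lagrangian C L d t s w" "z \<in> C"
  shows "x + z \<in> set_lagrangian C L d t s w"
proof -
  have "x + z \<in> set_lagrangian C L d t s w + C" using assms(2,3) by blast
  then show ?thesis
    by (simp add: set_lagrangian_def set_plus_rearrange3 convex_cone_plus[OF assms(1)])
qed

lemma aumann_integral_lagrangian_combine:
  assumes "convex_cone C" "a \<le> b" "b \<le> c"
  shows "aumann_integral C a b (\<lambda>s. set_lagrangian C L d t s (v s)) +
      aumann_integral C b c (\<lambda>s. set_lagrangian C L d t s (v s)) =
    aumann_integral C a c (\<lambda>s. set_lagrangian C L d t s (v s))"
  using assms by (intro aumann_integral_combine set_lagrangian_absorbs_cone)

text \<open>
  The correction term restores the discounting of the initial time: the integrand of \<open>W\<close> translates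
  selections for the discount \<open>d \<tau>\<close> into selections for \<open>d t\<close>, and likewise for the terminal cost.
\<close>

lemma W_plus_J_eq_rediscounted:
  assumes W: "W_integrand L d T t \<tau> \<eta> absolutely_integrable_on {\<tau>..T}"
  shows "W_plus_J C L g d T t \<tau> \<eta> =
    (d t T *\<^sub>R g (\<eta> T)) +o aumann_integral C \<tau> T (\<lambda>s. set_lagrangian C L d t s (weak_deriv \<tau> T \<eta> s))"
proof -
  have "(\<lambda>s. set_lagrangian C L d t s (weak_deriv \<tau> T \<eta> s)) =
    (\<lambda>s. W_integrand L d T t \<tau> \<eta> s +o set_lagrangian C L d \<tau> s (weak_deriv \<tau> T \<eta> s))"
    by (simp add: set_lagrangian_def W_integrand_def set_plus_rearrange2 flip: scaleR_add_left)
  then show ?thesis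
    using W by (simp add: aumann_integral_translate W_plus_J_def W_def J_def running_cost_def
        set_plus_rearrange2 algebra_simps)
qed

text \<open>
  Following \<open>y\<close> up to \<open>\<tau>\<close> and \<open>\<eta>\<close> afterwards is an admissible arc from \<open>(t, x)\<close>, whose cost is the sum
  on the left.
\<close>

lemma concatenation_subset_value_fun:
  fixes L :: "'a::euclidean_space \<Rightarrow> 'b::euclidean_space"
  assumes C: "convex_cone C" and t: "t \<le> \<tau>" "\<tau> \<le> T"
    and y: "y \<in> admissible T t x" and \<eta>: "\<eta> \<in> admissible T \<tau> (y \<tau>)"
  shows "running_cost C L d T t \<tau> y + W_plus_J C L g d T t \<tau> \<eta> \<subseteq> value_fun C L g d T t x"
proof (cases "W_integrand L d T t \<tau> \<eta> absolutely_integrable_on {\<tau>..T}")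
  case False
  then show ?thesis by (simp add: W_plus_J_def set_plus_def)
next
  case True
  define v where "v = (\<lambda>s. if s \<le> \<tau> then weak_deriv t T y s else weak_deriv \<tau> T \<eta> s)"
  define z where "z = (\<lambda>s. if s \<le> \<tau> then y s else \<eta> s)"
  have wy: "has_weak_derivative_on y (weak_deriv t T y) t T" "y t = x"
    and w\<eta>: "has_weak_derivative_on \<eta> (weak_deriv \<tau> T \<eta>) \<tau> T" "\<eta> \<tau> = y \<tau>"
    using y \<eta> by (auto simp: admissible_def intro: weak_deriv_has_weak_derivative)
  have wz: "has_weak_derivative_on z v t T"
    unfolding z_def v_def using t w\<eta>(2)
    by (intro has_weak_derivative_on_paste has_weak_derivative_on_subinterval[OF wy(1)] w\<eta>(1)) auto
  then have z: "z \<in> admissible T t x"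
    using t wy(2) by (auto simp: admissible_def W11_def z_def)
  obtain N where N: "negligible N" "\<And>s. s \<in> {t..T} - N \<Longrightarrow> weak_deriv t T z s = v s"
    using weak_deriv_AE_eq[OF wz] unfolding AE_lebesgue_on_Icc_iff by blast
  have "AE s in lebesgue_on {t..\<tau>}. weak_deriv t T y s = weak_deriv t T z s"
    unfolding AE_lebesgue_on_Icc_iff
    using t N by (intro exI[of _ N]) (auto simp: v_def)
  then have first: "running_cost C L d T t \<tau> y =
      aumann_integral C t \<tau> (\<lambda>s. set_lagrangian C L d t s (weak_deriv t T z s))"
    unfolding running_cost_def by (intro aumann_integral_cong_AE) (auto elim: eventually_mono)
  \<comment> \<open>At \<open>\<tau>\<close> itself \<open>v\<close> takes the value of the first arc, so this point joins the null set.\<close>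
  have "AE s in lebesgue_on {\<tau>..T}. weak_deriv \<tau> T \<eta> s = weak_deriv t T z s"
    unfolding AE_lebesgue_on_Icc_iff
    using t N by (intro exI[of _ "insert \<tau> N"]) (auto simp: v_def)
  then have second: "aumann_integral C \<tau> T (\<lambda>s. set_lagrangian C L d t s (weak_deriv \<tau> T \<eta> s)) =
      aumann_integral C \<tau> T (\<lambda>s. set_lagrangian C L d t s (weak_deriv t T z s))"
    by (intro aumann_integral_cong_AE) (auto elim: eventually_mono)
  have zT: "z T = \<eta> T" using t w\<eta>(2) by (auto simp: z_def)
  have "running_cost C L d T t \<tau> y + W_plus_J C L g d T t \<tau> \<eta> = J C L g d T t z"
    unfolding W_plus_J_eq_rediscounted[OF True] first second
    unfolding J_def running_cost_def zT
    by (simp add: set_plus_rearrange4 aumann_integral_lagrangian_combine[OF C t])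
  also have "\<dots> \<subseteq> value_fun C L g d T t x"
    unfolding value_fun_def inf_cl_def using z by (intro order_trans[OF _ closure_subset]) blast
  finally show ?thesis .
qed

text \<open>
  Closed upper bounds need to be checked on the members of the family only, because
  \<open>A + closure S \<subseteq> closure (A + S)\<close>.
\<close>

lemma cl_plus_inf_cl_subset:
  assumes "\<And>S. S \<in> \<A> \<Longrightarrow> A + S \<subseteq> R" "closed R"
  shows "cl_plus A (inf_cl \<A>) \<subseteq> R"
proof -
  have "A + closure (\<Union>\<A>) \<subseteq> closure A + closure (\<Union>\<A>)"
    by (intro set_plus_mono2 closure_subset order_refl)
  also have "\<dots> \<subseteq> closure (A + \<Union>\<A>)" by (rule closure_sum)
  also have "\<dots> \<subseteq> R" using assms by (intro closure_minimal) (auto simp: set_plus_def)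
  finally show ?thesis
    unfolding cl_plus_def inf_cl_def using assms(2) by (rule closure_minimal)
qed

text \<open>
  The obvious continuation of \<open>y\<close> after \<open>\<tau>\<close> is \<open>y\<close> itself, but it contributes nothing to the infimum
  if its correction term is not integrable.  Arcs with piecewise constant velocity and the same end
  points \<open>y \<tau>\<close> and \<open>y T\<close> are used instead: their correction terms are integrable, they pay the same
  terminal cost, and their running costs come arbitrarily close to that of \<open>y\<close>.
\<close>

lemma J_subset_dynamic_programming_set:
  fixes L :: "'a::euclidean_space \<Rightarrow> 'b::euclidean_space"
  assumes C: "convex_cone C" and epi: "convex (cone_epigraph C L)" "closed (cone_epigraph C L)"
    and t: "t \<le> \<tau>" "\<tau> \<le> T" and y: "y \<in> admissible T t x"
    and dt: "continuous_on {t..T} (d t)" "\<And>s. s \<in> {t..T} \<Longrightarrow> 0 < d t s"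
    and d\<tau>: "continuous_on {\<tau>..T} (d \<tau>)"
  shows "J C L g d T t y \<subseteq>
    cl_plus (running_cost C L d T t \<tau> y) (inf_cl (W_plus_J C L g d T t \<tau> ` admissible T \<tau> (y \<tau>)))"
proof
  fix q assume "q \<in> J C L g d T t y"
  let ?v = "weak_deriv t T y"
  let ?F = "\<lambda>s. set_lagrangian C L d t s (?v s)"
  let ?V = "\<Union>(W_plus_J C L g d T t \<tau> ` admissible T \<tau> (y \<tau>))"
  have wy: "has_weak_derivative_on y ?v \<tau> T"
    using y t by (intro has_weak_derivative_on_subinterval[OF weak_deriv_has_weak_derivative])
      (auto simp: admissible_def)
  from \<open>q \<in> J C L g d T t y\<close> have "q \<in> (d t T *\<^sub>R g (y T)) +o
      (running_cost C L d T t \<tau> y + aumann_integral C \<tau> T ?F)"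
    unfolding J_def running_cost_def aumann_integral_lagrangian_combine[OF C t] .
  then obtain q1 q2 where q: "q = d t T *\<^sub>R g (y T) + (q1 + q2)"
    and q1: "q1 \<in> running_cost C L d T t \<tau> y" and q2: "q2 \<in> aumann_integral C \<tau> T ?F"
    by (auto simp: elt_set_plus_def set_plus_def)
  have "d t T *\<^sub>R g (y T) + q2 \<in> closure ?V"
  proof (cases "\<tau> = T")
    case True
    have "y \<in> admissible T \<tau> (y \<tau>)" using wy by (auto simp: admissible_def W11_def)
    moreover have "W_integrand L d T t \<tau> y absolutely_integrable_on {\<tau>..T}"
      using absolutely_integrable_on_null[of \<tau> T "W_integrand L d T t \<tau> y"] True by simp
    ultimately show ?thesis
      using q2 True closure_subset[of ?V] by (fastforce simp: W_plus_J_eq_rediscounted aumann_integral_def)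
  next
    case False
    show ?thesis unfolding closure_approachable
    proof (intro allI impI)
      fix e :: real assume "0 < e"
      then have e2: "0 < e / 2" by simp
      obtain f where f: "q2 = integral {\<tau>..T} f" "f absolutely_integrable_on {\<tau>..T}"
        "AE s in lebesgue_on {\<tau>..T}. f s \<in> (d t s *\<^sub>R L (?v s)) +o C"
        using q2 False by (auto elim: aumann_integralE simp: set_lagrangian_def)
      have sub: "{\<tau>..T} \<subseteq> {t..T}" using t by auto
      have dtc: "continuous_on {\<tau>..T} (d t)" using dt(1) sub by (rule continuous_on_subset)
      have dtp: "0 < d t s" if "s \<in> {\<tau>..T}" for s using dt(2) sub that by blast
      have vi: "?v absolutely_integrable_on {\<tau>..T}"
        using wy unfolding has_weak_derivative_on_def by blast
      have yT: "y T = y \<tau> + integral {\<tau>..T} ?v"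
        using wy t(2) unfolding has_weak_derivative_on_def by (meson atLeastAtMost_iff order_refl)
      obtain u p where u: "u absolutely_integrable_on {\<tau>..T}" "integral {\<tau>..T} u = integral {\<tau>..T} ?v"
        and k: "\<And>k. continuous_on {\<tau>..T} k \<Longrightarrow> (\<lambda>s. k s *\<^sub>R L (u s)) absolutely_integrable_on {\<tau>..T}"
        and p: "p absolutely_integrable_on {\<tau>..T}"
          "\<And>s. s \<in> {\<tau>..T} \<Longrightarrow> p s \<in> (d t s *\<^sub>R L (u s)) +o C"
        and pf: "norm (integral {\<tau>..T} p - integral {\<tau>..T} f) \<le> e / 2"
        using piecewise_constant_velocity_approximation[OF C epi t(2) dtc dtp vi f(2,3) e2] by blast
      define \<eta> where "\<eta> = (\<lambda>s. y \<tau> + integral {\<tau>..s} u)"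
      have \<eta>\<tau>: "\<eta> \<tau> = y \<tau>" by (simp add: \<eta>_def)
      have \<eta>T: "\<eta> T = y T" by (simp add: \<eta>_def yT u(2))
      have w\<eta>: "has_weak_derivative_on \<eta> u \<tau> T"
        using u(1) unfolding has_weak_derivative_on_def by (simp add: \<eta>_def)
      then have \<eta>: "\<eta> \<in> admissible T \<tau> (y \<tau>)" using \<eta>\<tau> by (auto simp: admissible_def W11_def)
      have ae: "AE s in lebesgue_on {\<tau>..T}. weak_deriv \<tau> T \<eta> s = u s"
        by (rule weak_deriv_AE_eq[OF w\<eta>])
      have "W_integrand L d T t \<tau> \<eta> absolutely_integrable_on {\<tau>..T}"
      proof (rule absolutely_integrable_spike_AE)
        show "(\<lambda>s. (d t s - d \<tau> s) *\<^sub>R L (u s)) absolutely_integrable_on {\<tau>..T}"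
          by (intro k continuous_intros dtc d\<tau>)
        show "AE s in lebesgue_on {\<tau>..T}. W_integrand L d T t \<tau> \<eta> s = (d t s - d \<tau> s) *\<^sub>R L (u s)"
          using ae by eventually_elim (simp add: W_integrand_def)
      qed
      then have WJ: "W_plus_J C L g d T t \<tau> \<eta> = (d t T *\<^sub>R g (y T)) +o
          aumann_integral C \<tau> T (\<lambda>s. set_lagrangian C L d t s (weak_deriv \<tau> T \<eta> s))"
        by (simp add: W_plus_J_eq_rediscounted \<eta>T)
      have "AE s in lebesgue_on {\<tau>..T}. p s \<in> set_lagrangian C L d t s (weak_deriv \<tau> T \<eta> s)"
      proof -
        obtain N where "negligible N" "\<And>s. s \<in> {\<tau>..T} - N \<Longrightarrow> weak_deriv \<tau> T \<eta> s = u s"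
          using ae unfolding AE_lebesgue_on_Icc_iff by blast
        then show ?thesis
          unfolding AE_lebesgue_on_Icc_iff set_lagrangian_def using p(2) by (intro exI[of _ N]) auto
      qed
      from aumann_integralI[OF p(1) this False]
      have "d t T *\<^sub>R g (y T) + integral {\<tau>..T} p \<in> ?V" using \<eta> WJ by blast
      moreover have "dist (d t T *\<^sub>R g (y T) + integral {\<tau>..T} p) (d t T *\<^sub>R g (y T) + q2) < e"
        using pf \<open>0 < e\<close> by (simp add: f(1) dist_norm)
      ultimately show "\<exists>r\<in>?V. dist r (d t T *\<^sub>R g (y T) + q2) < e" by blast
    qed
  qed
  with q1 have "q1 + (d t T *\<^sub>R g (y T) + q2) \<in> running_cost C L d T t \<tau> y + closure ?V" by blast
  then show "q \<in> cl_plus (running_cost C L d T t \<tau> y)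
      (inf_cl (W_plus_J C L g d T t \<tau> ` admissible T \<tau> (y \<tau>)))"
    unfolding cl_plus_def inf_cl_def q using closure_subset by (fastforce simp: algebra_simps)
qed

text \<open>
  At \<open>\<tau> = T\<close> the remaining problem consists of the terminal cost alone.  This is where the
  condition for all \<open>\<tau>\<close> gives back the costs of the arcs in an infimizer.
\<close>

lemma terminal_dynamic_programming_set_subset:
  fixes L :: "'a::euclidean_space \<Rightarrow> 'b::euclidean_space"
  assumes C: "convex_cone C" and t: "t \<le> T"
  shows "cl_plus (running_cost C L d T t T y) (inf_cl (W_plus_J C L g d T t T ` admissible T T (y T)))
    \<subseteq> closure (J C L g d T t y)"
proof (rule cl_plus_inf_cl_subset)
  fix S assume "S \<in> W_plus_J C L g d T t T ` admissible T T (y T)"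
  then obtain \<eta> where S: "S = W_plus_J C L g d T t T \<eta>" and \<eta>: "\<eta> T = y T"
    by (auto simp: admissible_def)
  have "W_integrand L d T t T \<eta> absolutely_integrable_on {T..T}"
    using absolutely_integrable_on_null[of T T "W_integrand L d T t T \<eta>"] by simp
  then have "S = (d t T *\<^sub>R g (y T)) +o aumann_integral C T T (\<lambda>s. set_lagrangian C L d t s (weak_deriv t T y s))"
    unfolding S by (simp add: W_plus_J_eq_rediscounted \<eta> aumann_integral_def)
  then have "running_cost C L d T t T y + S = J C L g d T t y"
    unfolding J_def running_cost_def
    by (simp add: set_plus_rearrange4 aumann_integral_lagrangian_combine[OF C t])
  then show "running_cost C L d T t T y + S \<subseteq> closure (J C L g d T t y)"
    using closure_subset by blast
qed simp

theorem theorem4p1: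
  fixes C B :: "(real^'d) set"
    and L g :: "real^'n \<Rightarrow> real^'d"
    and d :: "real \<Rightarrow> real \<Rightarrow> real"
    and T a :: real
  assumes cone: "convex_cone C" "closed C" "interior C \<noteq> {}"
    and base: "is_base B (pos_dual C)"
    and T_pos: "0 < T"
    and h1: "\<forall>\<zeta>\<in>B. C2_fun (\<lambda>w. L w \<bullet> \<zeta>) \<and> strictly_convex (\<lambda>w. L w \<bullet> \<zeta>) \<and> coercive (\<lambda>w. L w \<bullet> \<zeta>)"
    and h2: "\<forall>\<zeta>\<in>B. \<exists>K. K-lipschitz_on UNIV (\<lambda>w. g w \<bullet> \<zeta>)"
    and a_pos: "0 < a"
    and h3: "\<forall>t\<in>{0..T}. continuous_on {t..T} (d t) \<and> d t ` {t..T} \<subseteq> {a<..1} \<and> d t t = 1"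
  shows "\<forall>t\<in>{0..T}. \<forall>x :: real^'n.
     (\<forall>y\<in>admissible T t x. \<forall>\<tau>\<in>{t..T}.
        value_fun C L g d T t x \<supseteq>
          cl_plus (running_cost C L d T t \<tau> y)
            (inf_cl (W_plus_J C L g d T t \<tau> ` admissible T \<tau> (y \<tau>)))) \<and>
     (\<forall>M. M \<subseteq> admissible T t x \<longrightarrow>
        (infimizer C L g d T t x M \<longleftrightarrow>
         (\<forall>\<tau>\<in>{t..T}.
            value_fun C L g d T t x =
              inf_cl ((\<lambda>y. cl_plus (running_cost C L d T t \<tau> y)
                (inf_cl (W_plus_J C L g d T t \<tau> ` admissible T \<tau> (y \<tau>)))) ` M))))"
proof (intro ballI allI)
  fix t and x :: "real^'n" assume t: "t \<in> {0..T}"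
  let ?U = "value_fun C L g d T t x"
  let ?J = "J C L g d T t"
  let ?R = "\<lambda>\<tau> y. cl_plus (running_cost C L d T t \<tau> y)
    (inf_cl (W_plus_J C L g d T t \<tau> ` admissible T \<tau> (y \<tau>)))"
  have conv: "convex_on UNIV (\<lambda>w. L w \<bullet> \<zeta>)" and cont: "continuous_on UNIV (\<lambda>w. L w \<bullet> \<zeta>)"
    if "\<zeta> \<in> B" for \<zeta>
    using h1 that by (auto intro: strictly_convex_imp_convex_on C2_fun_imp_continuous_on)
  note epi = convex_cone_epigraph[OF cone(1,2) base conv cont]
    closed_cone_epigraph[OF cone(1,2) base conv cont]
  have closed_U: "closed ?U" by (simp add: value_fun_def inf_cl_def)
  have R_U: "?R \<tau> y \<subseteq> ?U" if y: "y \<in> admissible T t x" and \<tau>: "\<tau> \<in> {t..T}" for \<tau> y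
  proof (rule cl_plus_inf_cl_subset[OF _ closed_U])
    fix S assume "S \<in> W_plus_J C L g d T t \<tau> ` admissible T \<tau> (y \<tau>)"
    with concatenation_subset_value_fun[OF cone(1) _ _ y] \<tau>
    show "running_cost C L d T t \<tau> y + S \<subseteq> ?U" by fastforce
  qed
  have J_R: "?J y \<subseteq> ?R \<tau> y" if y: "y \<in> admissible T t x" and \<tau>: "\<tau> \<in> {t..T}" for \<tau> y
  proof (rule J_subset_dynamic_programming_set[OF cone(1) epi _ _ y])
    show "t \<le> \<tau>" "\<tau> \<le> T" using \<tau> by auto
    show "continuous_on {t..T} (d t)" "continuous_on {\<tau>..T} (d \<tau>)" using h3 t \<tau> by auto
    show "0 < d t s" if "s \<in> {t..T}" for s
      using bspec[OF h3 t] that a_pos by (fastforce simp: image_subset_iff)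
  qed
  have "infimizer C L g d T t x M \<longleftrightarrow> (\<forall>\<tau>\<in>{t..T}. ?U = inf_cl (?R \<tau> ` M))"
    if M: "M \<subseteq> admissible T t x" for M
  proof
    assume "infimizer C L g d T t x M"
    then have U: "?U = closure (\<Union>(?J ` M))"
      by (simp add: infimizer_def value_fun_def inf_cl_def)
    show "\<forall>\<tau>\<in>{t..T}. ?U = inf_cl (?R \<tau> ` M)"
    proof (intro ballI equalityI)
      fix \<tau> assume \<tau>: "\<tau> \<in> {t..T}"
      have "\<Union>(?J ` M) \<subseteq> \<Union>(?R \<tau> ` M)" using J_R \<tau> M by blast
      then show "?U \<subseteq> inf_cl (?R \<tau> ` M)"
        unfolding U inf_cl_def[of "?R \<tau> ` M"] by (rule closure_mono)
      show "inf_cl (?R \<tau> ` M) \<subseteq> ?U"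
        unfolding inf_cl_def[of "?R \<tau> ` M"]
      proof (rule closure_minimal[OF UN_least closed_U])
        fix y assume "y \<in> M"
        with M have "y \<in> admissible T t x" by blast
        then show "?R \<tau> y \<subseteq> ?U" using \<tau> by (rule R_U)
      qed
    qed
  next
    assume "\<forall>\<tau>\<in>{t..T}. ?U = inf_cl (?R \<tau> ` M)"
    then have "?U = closure (\<Union>(?R T ` M))" using t by (simp add: inf_cl_def)
    also have "\<dots> \<subseteq> closure (\<Union>(?J ` M))"
    proof (rule closure_minimal)
      show "\<Union>(?R T ` M) \<subseteq> closure (\<Union>(?J ` M))"
      proof (rule UN_least)
        fix y assume "y \<in> M"
        then have "closure (?J y) \<subseteq> closure (\<Union>(?J ` M))" by (intro closure_mono) blast
        with terminal_dynamic_programming_set_subset[OF cone(1), of t T L d y g] t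
        show "?R T y \<subseteq> closure (\<Union>(?J ` M))" by auto
      qed
    qed simp
    finally have "?U \<subseteq> closure (\<Union>(?J ` M))" .
    moreover have "closure (\<Union>(?J ` M)) \<subseteq> ?U"
      unfolding value_fun_def inf_cl_def using M by (intro closure_mono) blast
    ultimately show "infimizer C L g d T t x M"
      by (simp add: infimizer_def value_fun_def inf_cl_def)
  qed
  with R_U show "(\<forall>y\<in>admissible T t x. \<forall>\<tau>\<in>{t..T}. ?U \<supseteq> ?R \<tau> y) \<and>
     (\<forall>M. M \<subseteq> admissible T t x \<longrightarrow>
        (infimizer C L g d T t x M \<longleftrightarrow> (\<forall>\<tau>\<in>{t..T}. ?U = inf_cl (?R \<tau> ` M))))"
    by blast
qed

end
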